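(* For every $\tau\in\mathcal{H}$ the following equalities hold: \[\theta\big[{\textstyle{1/4 \atop 1}}\big]'(\tau,0)=\tfrac{\pi i}{4}\theta\big[{\textstyle{1/4 \atop 1}}\big](\tau,0)\,\theta\big[{\textstyle{0 \atop 0}}\big]\big(\tfrac{\tau}{4},0\big)\Big(2\theta\big[{\textstyle{0 \atop 0}}\big]\big(\tfrac{\tau}{2},0\big)-\theta\big[{\textstyle{0 \atop 0}}\big]\big(\tfrac{\tau}{4},0\big)\Big),\] \[\theta\big[{\textstyle{3/4 \atop 1}}\big]'(\tau,0)=\tfrac{\pi i}{4}\theta\big[{\textstyle{3/4 \atop 1}}\big](\tau,0)\,\theta\big[{\textstyle{0 \atop 0}}\big]\big(\tfrac{\tau}{4},0\big)\Big(2\theta\big[{\textstyle{0 \atop 0}}\big]\big(\tfrac{\tau}{2},0\big)+\theta\big[{\textstyle{0 \atop 0}}\big]\big(\tfrac{\tau}{4},0\big)\Big),\] \[\theta\big[{\textstyle{1/4 \atop 0}}\big]'(\tau,0)=\tfrac{\pi i}{4}\theta\big[{\textstyle{1/4 \atop 0}}\big](\tau,0)\Big(2\theta\big[{\textstyle{0 \atop 0}}\big]\big(\tfrac{\tau}{2},0\big)\theta\big[{\textstyle{0 \atop 1}}\big]\big(\tfrac{\tau}{4},0\big)-\theta\big[{\textstyle{0 \atop 0}}\big]^{2}\big(\tfrac{\tau}{2},0\big)+\theta\big[{\textstyle{1 \atop 0}}\big]^{2}\big(\tfrac{\tau}{2},0\big)\Big),\] \[\theta\big[{\textstyle{3/4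 \atop 0}}\big]'(\tau,0)=\tfrac{\pi i}{4}\theta\big[{\textstyle{3/4 \atop 0}}\big](\tau,0)\Big(2\theta\big[{\textstyle{0 \atop 0}}\big]\big(\tfrac{\tau}{2},0\big)\theta\big[{\textstyle{0 \atop 1}}\big]\big(\tfrac{\tau}{4},0\big)+\theta\big[{\textstyle{0 \atop 0}}\big]^{2}\big(\tfrac{\tau}{2},0\big)-\theta\big[{\textstyle{1 \atop 0}}\big]^{2}\big(\tfrac{\tau}{2},0\big)\Big),\] \[\theta\big[{\textstyle{1/4 \atop 1/2}}\big]'(\tau,0)=\tfrac{\pi i}{4}\theta\big[{\textstyle{1/4 \atop 1/2}}\big](\tau,0)\Big[2\theta\big[{\textstyle{0 \atop 1}}\big]\big(\tfrac{\tau}{2},0\big)\Big(\theta\big[{\textstyle{0 \atop 0}}\big](\tau,0)-i\,\theta\big[{\textstyle{1 \atop 0}}\big](\tau,0)\Big)-\theta\big[{\textstyle{0 \atop 0}}\big]^{2}(\tau,0)+\theta\big[{\textstyle{1 \atop 0}}\big]^{2}(\tau,0)+i\,\theta\big[{\textstyle{1 \atop 0}}\big]^{2}\big(\tfrac{\tau}{2},0\big)\Big],\] \[\theta\big[{\textstyle{1/4 \atop 3/2}}\big]'(\tau,0)=\tfrac{\pi i}{4}\theta\big[{\textstyle{1/4 \atop 3/2}}\big](\tau,0)\Big[2\theta\big[{\textstyle{0 \atop 1}}\big]\big(\tfrac{\tau}{2},0\big)\Big(\theta\big[{\textstyle{0 \atop 0}}\big](\tau,0)+i\,\theta\big[{\textstyle{1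 \atop 0}}\big](\tau,0)\Big)-\theta\big[{\textstyle{0 \atop 0}}\big]^{2}(\tau,0)+\theta\big[{\textstyle{1 \atop 0}}\big]^{2}(\tau,0)-i\,\theta\big[{\textstyle{1 \atop 0}}\big]^{2}\big(\tfrac{\tau}{2},0\big)\Big],\] \[\theta\big[{\textstyle{3/4 \atop 1/2}}\big]'(\tau,0)=\tfrac{\pi i}{4}\theta\big[{\textstyle{3/4 \atop 1/2}}\big](\tau,0)\Big[2\theta\big[{\textstyle{0 \atop 1}}\big]\big(\tfrac{\tau}{2},0\big)\Big(\theta\big[{\textstyle{0 \atop 0}}\big](\tau,0)+i\,\theta\big[{\textstyle{1 \atop 0}}\big](\tau,0)\Big)+\theta\big[{\textstyle{0 \atop 0}}\big]^{2}(\tau,0)-\theta\big[{\textstyle{1 \atop 0}}\big]^{2}(\tau,0)+i\,\theta\big[{\textstyle{1 \atop 0}}\big]^{2}\big(\tfrac{\tau}{2},0\big)\Big],\] \[\theta\big[{\textstyle{3/4 \atop 3/2}}\big]'(\tau,0)=\tfrac{\pi i}{4}\theta\big[{\textstyle{3/4 \atop 3/2}}\big](\tau,0)\Big[2\theta\big[{\textstyle{0 \atop 1}}\big]\big(\tfrac{\tau}{2},0\big)\Big(\theta\big[{\textstyle{0 \atop 0}}\big](\tau,0)-i\,\theta\big[{\textstyle{1 \atop 0}}\big](\tau,0)\Big)+\theta\big[{\textstyle{0 \atop 0}}\big]^{2}(\tau,0)-\theta\big[{\textstyle{1 \atop 0}}\big]^{2}(\tau,0)-i\,\theta\big[{\textstyle{1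 \atop 0}}\big]^{2}\big(\tfrac{\tau}{2},0\big)\Big].\]
   Context: $\mathcal{H}$ is the upper half-plane and $\mathbf{e}(u)=e^{2\pi iu}$. For real $\varepsilon,\delta$, $\tau\in\mathcal{H}$ and $z\in\mathbb{C}$, the theta function with characteristics is \[\theta\big[{\textstyle{\varepsilon \atop \delta}}\big](\tau,z)=\sum_{n=-\infty}^{\infty}\mathbf{e}\Big[\big(n+\tfrac{\varepsilon}{2}\big)^{2}\tfrac{\tau}{2}+\big(n+\tfrac{\varepsilon}{2}\big)\big(z+\tfrac{\delta}{2}\big)\Big].\] The prime denotes differentiation with respect to $z$ only, so $\theta\big[{\varepsilon \atop \delta}\big]'(\tau,0)$ is the $z$-derivative at $z=0$. The notation $\theta\big[{\varepsilon \atop \delta}\big]^{2}(\tau,0)$ means the square of the value $\theta\big[{\varepsilon \atop \delta}\big](\tau,0)$. *)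

theory Defs
  imports "HOL-Analysis.Analysis"
begin

definition ee :: "complex \<Rightarrow> complex" where
  "ee u = exp (2 * of_real pi * \<i> * u)"

text \<open>The series converges absolutely whenever \<open>\<tau>\<close> lies in the upper half-plane, so the
  unordered sum over all integers agrees with the usual two-sided series. For other
  \<open>\<tau>\<close> the value is meaningless.\<close>

definition theta :: "real \<Rightarrow> real \<Rightarrow> complex \<Rightarrow> complex \<Rightarrow> complex" where
  "theta \<epsilon> \<delta> \<tau> z =
     (\<Sum>\<^sub>\<infinity>n::int. ee ((of_int n + of_real \<epsilon> / 2) ^ 2 * (\<tau> / 2)
                     + (of_int n + of_real \<epsilon> / 2) * (z + of_real \<delta> / 2)))"

definition theta' :: "real \<Rightarrow> real \<Rightarrow> complex \<Rightarrow> complex \<Rightarrow> complex" where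
  "theta' \<epsilon> \<delta> \<tau> z = deriv (\<lambda>w. theta \<epsilon> \<delta> \<tau> w) z"

end

theory Submission
  imports Defs "HOL-Complex_Analysis.Cauchy_Integral_Formula"
begin

text \<open>
With \<open>x = e(\<tau>/8)\<close>, every theta constant in the theorem is, up to an elementary factor, a series in
integral powers of \<open>x\<close>. For \<open>a = 1, 3\<close> the value and the derivative of
\<open>\<theta>[a/4, \<delta>](\<tau>, z)\<close> at \<open>z = 0\<close> have one common factor, and what remains is
\<open>A\<^sub>a(X) = \<Sum> X^(4n^2 + an)\<close> and \<open>A\<^sub>a'(X) = \<Sum> (8n + a) X^(4n^2 + an)\<close>
(\<open>octant\<close>, \<open>octant'\<close> below), where \<open>X = \<iota>x\<close> and \<open>\<iota>\<close> is the fourth root of unity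
that absorbs the phase of \<open>\<delta>\<close>. So the eight formulas are the four rotations of two identities,

  \<open>A\<^sub>1' = A\<^sub>1 \<phi>(-X) (2\<phi>(X^2) - \<phi>(-X))\<close> and
  \<open>A\<^sub>3' = A\<^sub>3 \<phi>(-X) (2\<phi>(X^2) + \<phi>(-X))\<close>, with \<open>\<phi>(X) = \<Sum> X^(n^2)\<close>.

These two are the sum and the difference of the following: the logarithmic derivatives
\<open>A\<^sub>1'/A\<^sub>1\<close> and \<open>A\<^sub>3'/A\<^sub>3\<close> add up to \<open>4\<phi>(-X)\<phi>(X^2)\<close> and differ by \<open>2\<phi>(-X)^2\<close>.
The point of passing to the sum and the difference is that the products
\<open>A\<^sub>1A\<^sub>3\<close> and \<open>A\<^sub>1A\<^sub>3' \<plusminus> A\<^sub>1'A\<^sub>3\<close> are double series which factor after a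
change of summation indices (a change of the lattice basis to sum and difference). The factors are
\<open>\<psi>(X) = \<Sum> X^(2n^2 + n)\<close> and its companion \<open>J(X) = \<Sum> (4n + 1) X^(2n^2 + n)\<close>.
What is then left is Jacobi's derivative formula \<open>J(X) = \<psi>(X) \<phi>(-X)^2\<close> and the relation
\<open>\<phi>(-X^2) \<psi>(-X) = \<phi>(-X) \<psi>(X)\<close>.

Both are obtained by descent: the same changes of indices show that the quotient \<open>R(X)\<close> of
the two sides satisfies \<open>R(X^2) = R(X)\<close>, and \<open>R(X) \<longrightarrow> 1\<close> as \<open>X \<longrightarrow> 0\<close>, so that
\<open>R = 1\<close> because the iterated squares of \<open>X\<close> tend to \<open>0\<close>. The same descent shows that
\<open>\<phi>\<close> and \<open>\<psi>\<close> have no zeros in the punctured unit disc, so that dividing is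
legitimate. Neither infinite products nor modular transformations enter.
\<close>

section \<open>Convergence, limits and derivatives of series indexed by the integers\<close>

lemma has_sum_product_complex:
  fixes f :: "'a \<Rightarrow> complex" and g :: "'b \<Rightarrow> complex"
  assumes f: "f summable_on A" and g: "g summable_on B"
  shows "((\<lambda>(a, b). f a * g b) has_sum infsum f A * infsum g B) (A \<times> B)"
proof (rule has_sum_SigmaI)
  show "((\<lambda>b. case (a, b) of (a, b) \<Rightarrow> f a * g b) has_sum f a * infsum g B) B" if "a \<in> A" for a
    using has_sum_cmult_right[OF has_sum_infsum[OF g]] by simp
  show "((\<lambda>a. f a * infsum g B) has_sum infsum f A * infsum g B) A"
    using has_sum_cmult_left[OF has_sum_infsum[OF f]] by simp
  have f': "(\<lambda>a. norm (f a)) summable_on A" and g': "(\<lambda>b. norm (g b)) summable_on B"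
    using f g by (simp_all add: summable_on_iff_abs_summable_on_complex)
  have "(\<lambda>p. norm (case p of (a, b) \<Rightarrow> f a * g b)) summable_on A \<times> B"
    unfolding Infinite_Sum.abs_summable_on_Sigma_iff
    using f' g'
    by (auto simp: norm_mult infsum_cmult_right' abs_mult
        intro!: summable_on_cmult_right summable_on_cmult_left)
  then show "(\<lambda>(a, b). f a * g b) summable_on A \<times> B"
    by (simp only: summable_on_iff_abs_summable_on_complex)
qed

lemma summable_on_int_linear_geometric:
  fixes r :: real
  assumes "0 \<le> r" "r < 1"
  shows "(\<lambda>n::int. (\<bar>real_of_int n\<bar> + 1) * r ^ nat \<bar>n\<bar>) summable_on UNIV"
proof -
  have *: "(\<lambda>n::nat. (real n + 1) * r ^ n) summable_on UNIV"
  proof (rule norm_summable_imp_summable_on)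
    have "summable (\<lambda>n. diffs (\<lambda>_. 1) n * r ^ n)"
      by (rule termdiff_converges[where K = 1]) (use assms in \<open>auto simp: summable_geometric\<close>)
    then show "summable (\<lambda>n. norm ((real n + 1) * r ^ n))"
      using assms by (simp add: diffs_def add.commute abs_mult)
  qed
  have 1: "(\<lambda>n::int. (\<bar>real_of_int n\<bar> + 1) * r ^ nat \<bar>n\<bar>) summable_on range int"
    by (subst summable_on_reindex) (use * in \<open>auto simp: o_def inj_on_def\<close>)
  have 2: "(\<lambda>n::int. (\<bar>real_of_int n\<bar> + 1) * r ^ nat \<bar>n\<bar>) summable_on range (\<lambda>n. - int n)"
    by (subst summable_on_reindex) (use * in \<open>auto simp: o_def inj_on_def\<close>)
  have "UNIV = range int \<union> range (\<lambda>n. - int n)"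
    by (auto intro: int_cases2)
  with summable_on_union[OF 1 2] show ?thesis by simp
qed

lemma summable_on_linear_powi:
  fixes x :: complex and c d :: int
  assumes x: "x \<noteq> 0" "norm x < 1" and e: "\<And>n. \<bar>n\<bar> \<le> e n + 1"
  shows "(\<lambda>n::int. of_int (c * n + d) * x powi e n) summable_on UNIV"
  unfolding summable_on_iff_abs_summable_on_complex
proof (rule Infinite_Sum.abs_summable_on_comparison_test')
  define r where "r = norm x"
  have r: "0 < r" "r < 1" using x by (auto simp: r_def)
  show "(\<lambda>n::int. (\<bar>c\<bar> + \<bar>d\<bar>) / r * ((\<bar>real_of_int n\<bar> + 1) * r ^ nat \<bar>n\<bar>)) summable_on UNIV"
    by (intro summable_on_cmult_right summable_on_int_linear_geometric) (use r in auto)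
  show "norm (of_int (c * n + d) * x powi e n)
          \<le> (\<bar>c\<bar> + \<bar>d\<bar>) / r * ((\<bar>real_of_int n\<bar> + 1) * r ^ nat \<bar>n\<bar>)" for n
  proof -
    have "r powi e n \<le> r powi (\<bar>n\<bar> - 1)"
      using r e[of n] by (intro power_int_decreasing) auto
    also have "\<dots> = r ^ nat \<bar>n\<bar> / r"
      using r by (simp add: power_int_diff power_int_nonneg_exp)
    finally have p: "r powi e n \<le> r ^ nat \<bar>n\<bar> / r" .
    have "\<bar>c * n + d\<bar> \<le> \<bar>c\<bar> * \<bar>n\<bar> + \<bar>d\<bar>"
      by (metis abs_mult abs_triangle_ineq)
    also have "\<dots> \<le> (\<bar>c\<bar> + \<bar>d\<bar>) * (\<bar>n\<bar> + 1)"
      by (simp add: algebra_simps)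
    finally have "real_of_int \<bar>c * n + d\<bar> \<le> of_int ((\<bar>c\<bar> + \<bar>d\<bar>) * (\<bar>n\<bar> + 1))"
      by (simp only: of_int_le_iff)
    then have q: "\<bar>real_of_int (c * n + d)\<bar> \<le> (\<bar>c\<bar> + \<bar>d\<bar>) * (\<bar>real_of_int n\<bar> + 1)"
      by simp
    have "norm (of_int (c * n + d) * x powi e n) = \<bar>real_of_int (c * n + d)\<bar> * r powi e n"
      by (simp only: norm_mult norm_of_int norm_power_int r_def)
    also have "\<dots> \<le> ((\<bar>c\<bar> + \<bar>d\<bar>) * (\<bar>real_of_int n\<bar> + 1)) * (r ^ nat \<bar>n\<bar> / r)"
      using q p r by (intro mult_mono) auto
    finally show ?thesis by (simp add: mult_ac)
  qed
qed

text \<open>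
The descent arguments need the value of a theta series as its nome tends to \<open>0\<close>: only the term
with exponent \<open>0\<close> survives, since the series converges uniformly near \<open>0\<close>.
\<close>

lemma tendsto_linear_powi_series:
  fixes e :: "int \<Rightarrow> int" and c d :: int
  assumes e: "\<And>n. \<bar>n\<bar> \<le> e n" "e 0 = 0"
  shows "((\<lambda>x::complex. \<Sum>\<^sub>\<infinity>n::int. of_int (c * n + d) * x powi e n) \<longlongrightarrow> of_int d) (at 0)"
proof -
  let ?F = "\<lambda>x::complex. \<Sum>\<^sub>\<infinity>n::int. of_int (c * n + d) * x powi e n"
  have e0: "e n \<ge> 0" for n using e(1)[of n] by linarith
  have sm: "(\<lambda>n::int. of_int (c * n + d) * (1/2::complex) powi e n) summable_on UNIV"
    by (rule summable_on_linear_powi) (use e in \<open>auto intro: order_trans[OF e(1)]\<close>)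
  have "uniform_limit (cball 0 (1/2)) (\<lambda>X x. \<Sum>n\<in>X. of_int (c * n + d) * x powi e n) ?F
          (finite_subsets_at_top UNIV)"
  proof (rule Weierstrass_m_test_general)
    show "(\<lambda>n. norm (of_int (c * n + d) * (1/2::complex) powi e n)) summable_on UNIV"
      using sm by (simp add: summable_on_iff_abs_summable_on_complex)
    show "norm (of_int (c * n + d) * x powi e n) \<le> norm (of_int (c * n + d) * (1/2::complex) powi e n)"
      if "x \<in> cball 0 (1/2)" for n and x :: complex
      using that e0 unfolding norm_mult norm_power_int
      by (intro mult_left_mono power_int_mono) auto
  qed
  then have "continuous_on (cball 0 (1/2)) ?F"
    by (rule uniform_limit_theorem[rotated])
       (use e0 in \<open>auto intro!: continuous_intros always_eventually\<close>)
  then have "isCont ?F 0"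
    by (rule continuous_on_interior) auto
  then have "(?F \<longlongrightarrow> ?F 0) (at 0)" by (simp add: isCont_def)
  moreover have "?F 0 = of_int d"
  proof -
    have "e n = 0 \<longleftrightarrow> n = 0" for n using e(1)[of n] e(2) by auto
    then have "?F 0 = (\<Sum>\<^sub>\<infinity>n\<in>{0::int}. of_int (c * n + d) * (0::complex) powi e n)"
      by (intro infsum_cong_neutral) (auto simp: power_int_0_left_if)
    then show ?thesis by (simp add: e)
  qed
  ultimately show ?thesis by simp
qed

text \<open>
For holomorphic terms a summable majorant of the terms themselves is enough; the derivatives are
controlled by Cauchy's estimates, which are behind the limit theorem used here.
\<close>

lemma has_field_derivative_infsum:
  fixes f f' :: "'a \<Rightarrow> complex \<Rightarrow> complex"
  assumes deriv: "\<And>n w. (f n has_field_derivative f' n w) (at w)"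
    and r: "0 < r" and le: "\<And>n w. norm (w - z) \<le> r \<Longrightarrow> norm (f n w) \<le> M n" and M: "M summable_on A"
    and f': "(\<lambda>n. f' n z) summable_on A"
  shows "((\<lambda>w. \<Sum>\<^sub>\<infinity>n\<in>A. f n w) has_field_derivative (\<Sum>\<^sub>\<infinity>n\<in>A. f' n z)) (at z)"
proof -
  have ul: "uniform_limit (cball z r) (\<lambda>X w. \<Sum>n\<in>X. f n w) (\<lambda>w. \<Sum>\<^sub>\<infinity>n\<in>A. f n w) (finite_subsets_at_top A)"
    by (rule Weierstrass_m_test_general[OF _ M]) (auto intro: le simp: dist_norm norm_minus_commute)
  have cont: "continuous_on S (f n)" for S n
    using deriv by (meson DERIV_continuous_on has_field_derivative_at_within)
  obtain g' where g': "\<And>w. w \<in> ball z r \<Longrightarrow>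
      ((\<lambda>w. \<Sum>\<^sub>\<infinity>n\<in>A. f n w) has_field_derivative g' w) (at w) \<and>
      ((\<lambda>X. \<Sum>n\<in>X. f' n w) \<longlongrightarrow> g' w) (finite_subsets_at_top A)"
  proof (rule has_complex_derivative_uniform_limit[OF _ ul _ r])
    show "\<forall>\<^sub>F X in finite_subsets_at_top A. continuous_on (cball z r) (\<lambda>w. \<Sum>n\<in>X. f n w) \<and>
            (\<forall>w\<in>ball z r. ((\<lambda>w. \<Sum>n\<in>X. f n w) has_field_derivative (\<Sum>n\<in>X. f' n w)) (at w))"
      by (intro always_eventually allI conjI ballI continuous_on_sum cont DERIV_sum deriv)
  qed auto
  have "((\<lambda>X. \<Sum>n\<in>X. f' n z) \<longlongrightarrow> (\<Sum>\<^sub>\<infinity>n\<in>A. f' n z)) (finite_subsets_at_top A)"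
    using has_sum_infsum[OF f'] by (simp add: has_sum_def)
  with g'[of z] r have "g' z = (\<Sum>\<^sub>\<infinity>n\<in>A. f' n z)"
    by (auto intro: tendsto_unique[OF finite_subsets_at_top_neq_bot])
  with g'[of z] r show ?thesis by simp
qed

section \<open>Changes of the summation indices in double series\<close>

text \<open>
The map \<open>(s, d) \<mapsto> (s + d, s - d)\<close> is a bijection from pairs of integers to pairs of equal
parity. If the terms of a double series factor in both coordinates, this turns a product of two
series into the bilinear combination of even and odd parts.
\<close>

lemma parity_same_infsum:
  fixes a b f g :: "int \<Rightarrow> complex"
  assumes "a summable_on UNIV" "b summable_on UNIV" and f: "f summable_on UNIV" and g: "g summable_on UNIV"
    and eq: "\<And>s d. a s * b d = f (s + d) * g (s - d)"
  shows "infsum a UNIV * infsum b UNIV =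
    infsum f {n. even n} * infsum g {n. even n} + infsum f {n. odd n} * infsum g {n. odd n}" (is "_ = ?R")
proof -
  let ?S = "{n. even n} \<times> {n. even n} \<union> {n. odd n} \<times> {n. odd n} :: (int \<times> int) set"
  have sub: "f summable_on S" "g summable_on S" for S
    using f g summable_on_subset_banach by blast+
  have "((\<lambda>(n, m). f n * g m) has_sum ?R) ?S"
    by (intro has_sum_Un_disjoint has_sum_product_complex sub) auto
  moreover have "((\<lambda>(n, m). f n * g m) has_sum ?R) ?S \<longleftrightarrow> ((\<lambda>(s, d). a s * b d) has_sum ?R) UNIV"
  proof (rule has_sum_reindex_bij_witness[where i = "\<lambda>(s, d). (s + d, s - d)"
          and j = "\<lambda>(n, m). ((n + m) div 2, (n - m) div 2)"])
    fix p :: "int \<times> int" assume p: "p \<in> ?S"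
    have "(n + m) div 2 + (n - m) div 2 = n \<and> (n + m) div 2 - (n - m) div 2 = m"
      if "even (n + m)" for n m :: int
      using that by presburger
    with p show "(case case p of (n, m) \<Rightarrow> ((n + m) div 2, (n - m) div 2) of (s, d) \<Rightarrow> (s + d, s - d)) = p"
      and "(case case p of (n, m) \<Rightarrow> ((n + m) div 2, (n - m) div 2) of (s, d) \<Rightarrow> a s * b d)
             = (case p of (n, m) \<Rightarrow> f n * g m)"
      by (auto simp: eq)
  qed auto
  ultimately have "((\<lambda>(s, d). a s * b d) has_sum ?R) (UNIV \<times> UNIV)" by simp
  with has_sum_product_complex[OF assms(1,2)] show ?thesis
    by (rule has_sum_unique)
qed

text \<open>
The same for pairs of opposite parity, which are reached by \<open>(s, d) \<mapsto> (s + d + 1, s - d)\<close>.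
\<close>

lemma parity_opposite_infsum:
  fixes a b f g :: "int \<Rightarrow> complex"
  assumes "a summable_on UNIV" "b summable_on UNIV" and f: "f summable_on UNIV" and g: "g summable_on UNIV"
    and eq: "\<And>s d. a s * b d = f (s + d + 1) * g (s - d)"
  shows "infsum a UNIV * infsum b UNIV =
    infsum f {n. odd n} * infsum g {n. even n} + infsum f {n. even n} * infsum g {n. odd n}" (is "_ = ?R")
proof -
  let ?S = "{n. odd n} \<times> {n. even n} \<union> {n. even n} \<times> {n. odd n} :: (int \<times> int) set"
  have sub: "f summable_on S" "g summable_on S" for S
    using f g summable_on_subset_banach by blast+
  have "((\<lambda>(n, m). f n * g m) has_sum ?R) ?S"
    by (intro has_sum_Un_disjoint has_sum_product_complex sub) auto
  moreover have "((\<lambda>(n, m). f n * g m) has_sum ?R) ?S \<longleftrightarrow> ((\<lambda>(s, d). a s * b d) has_sum ?R) UNIV"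
  proof (rule has_sum_reindex_bij_witness[where i = "\<lambda>(s, d). (s + d + 1, s - d)"
          and j = "\<lambda>(n, m). ((n + m - 1) div 2, (n - m - 1) div 2)"])
    fix p :: "int \<times> int" assume p: "p \<in> ?S"
    have "(n + m - 1) div 2 + (n - m - 1) div 2 + 1 = n \<and> (n + m - 1) div 2 - (n - m - 1) div 2 = m"
      if "odd (n + m)" for n m :: int
      using that by presburger
    with p show "(case case p of (n, m) \<Rightarrow> ((n + m - 1) div 2, (n - m - 1) div 2) of
                    (s, d) \<Rightarrow> (s + d + 1, s - d)) = p"
      and "(case case p of (n, m) \<Rightarrow> ((n + m - 1) div 2, (n - m - 1) div 2) of (s, d) \<Rightarrow> a s * b d)
             = (case p of (n, m) \<Rightarrow> f n * g m)"
      by (auto simp: eq)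
  next
    fix p :: "int \<times> int"
    show "(case case p of (s, d) \<Rightarrow> (s + d + 1, s - d) of
            (n, m) \<Rightarrow> ((n + m - 1) div 2, (n - m - 1) div 2)) = p"
      by (cases p) auto
    show "(case p of (s, d) \<Rightarrow> (s + d + 1, s - d)) \<in> ?S"
      by (cases p) auto
  qed auto
  ultimately have "((\<lambda>(s, d). a s * b d) has_sum ?R) (UNIV \<times> UNIV)" by simp
  with has_sum_product_complex[OF assms(1,2)] show ?thesis
    by (rule has_sum_unique)
qed

text \<open>
Here \<open>(n, m)\<close> is replaced by \<open>(k, j)\<close> with \<open>j = n - m\<close> and \<open>2(n + m) + 1 = (-1)^j (4k + 1)\<close>.
For odd numbers \<open>4n + 1\<close> and \<open>4m + 1\<close> this is the passage to half the sum and half the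
difference: half the sum is odd, and it is congruent to \<open>1\<close> or to \<open>3\<close> modulo \<open>4\<close>
according to the parity of \<open>j\<close>; folding the second case onto the first by a change of sign makes
\<open>k\<close> and \<open>j\<close> independent, so that the double series becomes a product.
\<close>

lemma folded_reindex_infsum:
  fixes a b :: "int \<Rightarrow> complex" and h :: "int \<times> int \<Rightarrow> complex"
  assumes h: "(h has_sum H) UNIV" and ab: "a summable_on UNIV" "b summable_on UNIV"
    and even: "\<And>k l. h (k + l, k - l) = a k * b (2 * l)"
    and odd: "\<And>k l. h (l - k, - k - l - 1) = a k * b (2 * l + 1)"
  shows "H = infsum a UNIV * infsum b UNIV"
proof -
  have "(h has_sum H) UNIV \<longleftrightarrow> ((\<lambda>(k, j). a k * b j) has_sum H) UNIV"
  proof (rule has_sum_reindex_bij_witness[where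
        i = "\<lambda>(k, j). if even j then (k + j div 2, k - j div 2) else (j div 2 - k, - k - j div 2 - 1)"
        and j = "\<lambda>(n, m). (if even (n + m) then (n + m) div 2 else (- n - m - 1) div 2, n - m)"])
    fix p :: "int \<times> int"
    obtain n m where p: "p = (n, m)" by (cases p)
    show "(case case p of (n, m) \<Rightarrow> (if even (n + m) then (n + m) div 2 else (- n - m - 1) div 2, n - m) of
            (k, j) \<Rightarrow> a k * b j) = h p"
    proof (cases "even (n + m)")
      case True
      then obtain k where k: "n + m = 2 * k" by (elim evenE)
      define l where "l = k - m"
      have nm: "n = k + l" "m = k - l" using k by (auto simp: l_def)
      have "(n + m) div 2 = k" "n - m = 2 * l" unfolding nm by auto
      moreover have "h (n, m) = a k * b (2 * l)" unfolding nm by (rule even)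
      ultimately show ?thesis using p True by simp
    next
      case False
      then obtain k' where k': "n + m = 2 * k' + 1" by (elim oddE)
      define k l where "k = - k' - 1" and "l = n + k"
      have nm: "n = l - k" "m = - k - l - 1" using k' by (auto simp: l_def k_def)
      have "(- n - m - 1) div 2 = k" "n - m = 2 * l + 1" unfolding nm by auto
      moreover have "h (n, m) = a k * b (2 * l + 1)" unfolding nm by (rule odd)
      ultimately show ?thesis using p False by simp
    qed
  next
    fix p :: "int \<times> int"
    show "(case case p of (n, m) \<Rightarrow> (if even (n + m) then (n + m) div 2 else (- n - m - 1) div 2, n - m) of
       (k, j) \<Rightarrow> if even j then (k + j div 2, k - j div 2) else (j div 2 - k, - k - j div 2 - 1)) = p"
      by (cases p) (auto; presburger)
  next
    fix p :: "int \<times> int"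
    show "(case case p of (k, j) \<Rightarrow> if even j then (k + j div 2, k - j div 2) else (j div 2 - k, - k - j div 2 - 1) of
       (n, m) \<Rightarrow> (if even (n + m) then (n + m) div 2 else (- n - m - 1) div 2, n - m)) = p"
      by (cases p) (auto; presburger)
  qed auto
  with h have "((\<lambda>(k, j). a k * b j) has_sum H) (UNIV \<times> UNIV)" by simp
  from has_sum_unique[OF this has_sum_product_complex[OF ab]] show ?thesis .
qed

section \<open>Theta series in the nome and their product identities\<close>

definition phi :: "complex \<Rightarrow> complex" where
  "phi x = (\<Sum>\<^sub>\<infinity>n::int. x powi n\<^sup>2)"

definition psi :: "complex \<Rightarrow> complex" where
  "psi x = (\<Sum>\<^sub>\<infinity>n::int. x powi (2 * n\<^sup>2 + n))"

text \<open>
Up to a power of the nome and a constant, this is the \<open>z\<close>-derivative at \<open>0\<close> of the odd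
theta function \<open>\<theta>[1, 1]\<close>.
\<close>

definition jac :: "complex \<Rightarrow> complex" where
  "jac x = (\<Sum>\<^sub>\<infinity>n::int. of_int (4 * n + 1) * x powi (2 * n\<^sup>2 + n))"

text \<open>
The values and derivatives of \<open>\<theta>[a/4, \<delta>]\<close> at \<open>z = 0\<close> without their elementary factors,
see \<open>theta_eighth\<close>. The weight \<open>8n + a\<close> comes from differentiating \<open>e((n + a/8)z)\<close>.
\<close>

definition octant :: "int \<Rightarrow> complex \<Rightarrow> complex" where
  "octant a x = (\<Sum>\<^sub>\<infinity>n::int. x powi (4 * n\<^sup>2 + a * n))"

definition octant' :: "int \<Rightarrow> complex \<Rightarrow> complex" where
  "octant' a x = (\<Sum>\<^sub>\<infinity>n::int. of_int (8 * n + a) * x powi (4 * n\<^sup>2 + a * n))"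

definition phi_even :: "complex \<Rightarrow> complex" where
  "phi_even x = (\<Sum>\<^sub>\<infinity>n\<in>{n::int. even n}. x powi n\<^sup>2)"

definition phi_odd :: "complex \<Rightarrow> complex" where
  "phi_odd x = (\<Sum>\<^sub>\<infinity>n\<in>{n::int. odd n}. x powi n\<^sup>2)"

lemma quadratic_exponent_bounds:
  fixes n :: int
  shows "\<bar>n\<bar> \<le> n\<^sup>2" "\<bar>n\<bar> \<le> 2 * n\<^sup>2 + n" "\<bar>n\<bar> \<le> 4 * n\<^sup>2 + n" "\<bar>n\<bar> \<le> 4 * n\<^sup>2 + 3 * n"
    "\<bar>n\<bar> \<le> 2 * n\<^sup>2 + 2 * n + 1"
proof -
  have *: "\<bar>n\<bar> \<le> n\<^sup>2"
    using self_le_power[of "\<bar>n\<bar>" 2] by (cases "n = 0") auto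
  show "\<bar>n\<bar> \<le> n\<^sup>2" "\<bar>n\<bar> \<le> 2 * n\<^sup>2 + n" "\<bar>n\<bar> \<le> 4 * n\<^sup>2 + n" "\<bar>n\<bar> \<le> 4 * n\<^sup>2 + 3 * n"
    using * by linarith+
  have "0 \<le> (n + 1)\<^sup>2 + n\<^sup>2 - \<bar>n\<bar>"
    using * zero_le_power2[of "n + 1"] by linarith
  then show "\<bar>n\<bar> \<le> 2 * n\<^sup>2 + 2 * n + 1"
    by (simp add: power2_eq_square algebra_simps)
qed

lemma summable_on_powi:
  fixes x :: complex
  assumes "x \<noteq> 0" "norm x < 1" "\<And>n. \<bar>n\<bar> \<le> e n + 1"
  shows "(\<lambda>n::int. x powi e n) summable_on UNIV"
  using summable_on_linear_powi[OF assms, of 0 1] by simp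

lemma le_Suc_int: "a \<le> b \<Longrightarrow> a \<le> b + 1" for a b :: int by simp

lemmas summable_intros = summable_on_powi summable_on_linear_powi
  quadratic_exponent_bounds[THEN le_Suc_int]

lemma powi_sq: "(x\<^sup>2) powi n = x powi (2 * n)" "(x ^ 4) powi n = x powi (4 * n)" for x :: complex
  by (simp_all add: power_int_power)

lemma powi_cong: "x powi n = x powi m" if "n = m" for x :: complex using that by simp

context
  fixes x :: complex
  assumes x: "x \<noteq> 0" "norm x < 1"
begin

lemma norm_power_nome: "norm (x\<^sup>2) < 1" "norm (x^4) < 1" "norm (-x) < 1" "norm (-(x\<^sup>2)) < 1" "norm (- (x^4)) < 1"
  using x by (auto simp: norm_power power_less_one_iff)

lemma phi_split: "phi x = phi_even x + phi_odd x"
proof -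
  have s: "(\<lambda>n. x powi n\<^sup>2) summable_on S" for S :: "int set"
    using summable_on_subset_banach[OF summable_on_powi[OF x, of "\<lambda>n. n\<^sup>2"]]
    by (simp add: quadratic_exponent_bounds(1) le_Suc_int)
  have "phi x = infsum (\<lambda>n. x powi n\<^sup>2) ({n. even n} \<union> {n. odd n})"
    unfolding phi_def by (rule arg_cong[where f = "infsum _"]) auto
  also have "\<dots> = phi_even x + phi_odd x"
    unfolding phi_even_def phi_odd_def by (rule infsum_Un_disjoint) (auto intro: s)
  finally show ?thesis .
qed

lemma phi_even_eq: "phi_even x = phi (x ^ 4)"
  unfolding phi_even_def phi_def
  by (rule infsum_reindex_bij_witness[where i = "\<lambda>n. 2 * n" and j = "\<lambda>n. n div 2"])
     (auto simp: powi_sq elim!: evenE)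

text \<open>
The identity \<open>(s + d)^2 + (s - d)^2 = 2(s^2 + d^2)\<close> makes \<open>parity_same_infsum\<close> applicable. The
signs in \<open>sq_phi_neg\<close> and \<open>psi_psi_neg\<close> make the odd parts enter with a minus sign there.
\<close>

lemma sq_phi: "phi (x\<^sup>2) ^ 2 = phi_even x ^ 2 + phi_odd x ^ 2"
proof -
  have "phi (x\<^sup>2) * phi (x\<^sup>2) = phi_even x * phi_even x + phi_odd x * phi_odd x"
    unfolding phi_def phi_even_def phi_odd_def
  proof (rule parity_same_infsum)
    show "x\<^sup>2 powi s\<^sup>2 * x\<^sup>2 powi d\<^sup>2 = x powi (s + d)\<^sup>2 * x powi (s - d)\<^sup>2" for s d
      using x unfolding powi_sq by (simp flip: power_int_add) (intro powi_cong, simp add: power2_eq_square algebra_simps)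
  qed (use x norm_power_nome in \<open>auto intro!: summable_intros\<close>)
  then show ?thesis by (simp add: power2_eq_square)
qed

lemma phi_even_rotate:
  assumes "\<iota> ^ 4 = 1"
  shows "phi_even (\<iota> * x) = phi_even x"
  unfolding phi_even_def
proof (rule infsum_cong)
  fix n :: int assume "n \<in> {n. even n}"
  then obtain k where "n = 2 * k" by (auto elim: evenE)
  then have "n\<^sup>2 = 4 * k\<^sup>2" by (simp add: power2_eq_square)
  then show "(\<iota> * x) powi n\<^sup>2 = x powi n\<^sup>2"
    using assms by (simp add: power_int_mult power_mult_distrib)
qed

lemma phi_odd_rotate:
  assumes "\<iota> ^ 4 = 1"
  shows "phi_odd (\<iota> * x) = \<iota> * phi_odd x"
proof -
  have "phi_odd (\<iota> * x) = (\<Sum>\<^sub>\<infinity>n\<in>{n. odd n}. \<iota> * (x powi n\<^sup>2))"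
    unfolding phi_odd_def
  proof (rule infsum_cong)
    fix n :: int assume "n \<in> {n. odd n}"
    then obtain k where "n = 2 * k + 1" by (auto elim: oddE)
    then have n: "n\<^sup>2 = 4 * (k\<^sup>2 + k) + 1" by (simp add: power2_eq_square algebra_simps)
    have "\<iota> powi (4 * (k\<^sup>2 + k)) = 1"
      unfolding power_int_mult using assms by simp
    moreover have "\<iota> \<noteq> 0" using assms by auto
    ultimately have "\<iota> powi n\<^sup>2 = \<iota>"
      unfolding n by (subst power_int_add) (simp_all del: distrib_left_numeral)
    then show "(\<iota> * x) powi n\<^sup>2 = \<iota> * x powi n\<^sup>2"
      by (simp add: power_int_mult_distrib)
  qed
  then show ?thesis by (simp add: phi_odd_def infsum_cmult_right')
qed

lemma phi_even_neg: "phi_even (-x) = phi_even x" and phi_odd_neg: "phi_odd (-x) = - phi_odd x"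
  using phi_even_rotate[of "-1"] phi_odd_rotate[of "-1"] by simp_all

lemma sq_phi_neg: "phi (-(x\<^sup>2)) ^ 2 = phi_even x ^ 2 - phi_odd x ^ 2"
proof -
  have "phi (-(x\<^sup>2)) * phi (-(x\<^sup>2)) = phi_even (-x) * phi_even x + phi_odd (-x) * phi_odd x"
    unfolding phi_def phi_even_def phi_odd_def
  proof (rule parity_same_infsum)
    show "(-x\<^sup>2) powi s\<^sup>2 * (-x\<^sup>2) powi d\<^sup>2 = (-x) powi (s + d)\<^sup>2 * x powi (s - d)\<^sup>2" for s d
      using x unfolding power_int_minus_left powi_sq
      by (simp flip: power_int_add) (intro conjI impI powi_cong, simp_all add: power2_eq_square algebra_simps)
  qed (use x norm_power_nome in \<open>auto intro!: summable_intros\<close>)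
  then show ?thesis by (simp add: power2_eq_square phi_even_neg phi_odd_neg)
qed

lemma psi_psi_neg: "psi x * psi (-x) = psi (-(x\<^sup>2)) * phi (-(x^4))"
proof -
  define u where "u y S = (\<Sum>\<^sub>\<infinity>n\<in>S. y powi (2 * n\<^sup>2 + n))" for y :: complex and S :: "int set"
  have even: "u (-x) {n. even n} = u x {n. even n}"
    unfolding u_def by (rule infsum_cong) (simp add: power_int_minus_left)
  have "u (-x) {n. odd n} = (\<Sum>\<^sub>\<infinity>n\<in>{n. odd n}. - (x powi (2 * n\<^sup>2 + n)))"
    unfolding u_def by (rule infsum_cong) (simp add: power_int_minus_left)
  then have odd: "u (-x) {n. odd n} = - u x {n. odd n}"
    unfolding u_def by (simp add: infsum_uminus)
  have split: "psi y = u y {n. even n} + u y {n. odd n}" if y: "y \<noteq> 0" "norm y < 1" for y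
  proof -
    have s: "(\<lambda>n. y powi (2 * n\<^sup>2 + n)) summable_on S" for S :: "int set"
      using summable_on_subset_banach[OF summable_on_powi[of y "\<lambda>n. 2 * n\<^sup>2 + n"]] y
      by (auto simp: quadratic_exponent_bounds(2) le_Suc_int)
    have "psi y = u y ({n. even n} \<union> {n. odd n})"
      unfolding psi_def u_def by (rule arg_cong[where f = "infsum _"]) auto
    then show ?thesis
      unfolding u_def by (simp add: infsum_Un_disjoint s disjoint_iff)
  qed
  have "psi (-(x\<^sup>2)) * phi (-(x^4))
      = u (-x) {n. even n} * u x {n. even n} + u (-x) {n. odd n} * u x {n. odd n}"
    unfolding phi_def psi_def u_def
  proof (rule parity_same_infsum)
    show "(-x\<^sup>2) powi (2 * s\<^sup>2 + s) * (-(x^4)) powi d\<^sup>2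
        = (-x) powi (2 * (s + d)\<^sup>2 + (s + d)) * x powi (2 * (s - d)\<^sup>2 + (s - d))" for s d
      using x unfolding power_int_minus_left powi_sq
      by (simp flip: power_int_add) (intro conjI impI powi_cong, simp_all add: power2_eq_square algebra_simps)
  qed (use x norm_power_nome in \<open>auto intro!: summable_intros\<close>)
  moreover have "psi (-x) = u x {n. even n} - u x {n. odd n}"
    using split[of "-x"] x even odd by simp
  moreover have "psi x = u x {n. even n} + u x {n. odd n}"
    using split x by simp
  ultimately show ?thesis
    by (simp only: even odd) (simp add: algebra_simps)
qed

text \<open>
This identity and the ones below on \<open>jac\<close> and \<open>octant\<close> are instances of one change of indices,
\<open>folded_reindex_infsum\<close>.
A weight linear in \<open>2(n + m) + 1\<close> turns into \<open>(-1)^j (4k + 1)\<close> and so produces \<open>jac\<close> in the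
index \<open>k\<close>, while the sign \<open>(-1)^j\<close> negates the argument of the other factor. A weight in
\<open>n - m\<close> produces \<open>jac\<close> in the index \<open>j\<close>.
\<close>

lemma psi_sq: "psi x ^ 2 = phi x * psi (x\<^sup>2)"
proof -
  have "psi x * psi x = psi (x\<^sup>2) * phi x"
    unfolding psi_def phi_def
  proof (rule folded_reindex_infsum[OF has_sum_product_complex[of _ UNIV _ UNIV, simplified]])
    show "(case (k + l, k - l) of (n, m) \<Rightarrow> x powi (2 * n\<^sup>2 + n) * x powi (2 * m\<^sup>2 + m))
       = x\<^sup>2 powi (2 * k\<^sup>2 + k) * x powi (2 * l)\<^sup>2" for k l
      using x unfolding powi_sq prod.case
      by (simp flip: power_int_add) (intro powi_cong, simp add: power2_eq_square algebra_simps)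
    show "(case (l - k, - k - l - 1) of (n, m) \<Rightarrow> x powi (2 * n\<^sup>2 + n) * x powi (2 * m\<^sup>2 + m))
       = x\<^sup>2 powi (2 * k\<^sup>2 + k) * x powi (2 * l + 1)\<^sup>2" for k l
      using x unfolding powi_sq prod.case
      by (simp flip: power_int_add) (intro powi_cong, simp add: power2_eq_square algebra_simps)
  qed (use x norm_power_nome in \<open>auto intro!: summable_intros\<close>)
  then show ?thesis by (simp add: power2_eq_square)
qed

lemma jac_psi: "jac x * psi x = jac (x\<^sup>2) * phi (-x)"
proof -
  let ?p = "\<lambda>n. x powi (2 * n\<^sup>2 + n)" and ?j = "\<lambda>n. of_int (4 * n + 1) * x powi (2 * n\<^sup>2 + n)"
  have s: "?p summable_on UNIV" "?j summable_on UNIV"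
    by (intro summable_intros x)+
  have "jac x * psi x + psi x * jac x = (\<Sum>\<^sub>\<infinity>k. 2 * (of_int (4 * k + 1) * x\<^sup>2 powi (2 * k\<^sup>2 + k))) * phi (-x)"
    unfolding phi_def
  proof (rule folded_reindex_infsum)
    show "((\<lambda>p. (case p of (n, m) \<Rightarrow> ?j n * ?p m) + (case p of (n, m) \<Rightarrow> ?p n * ?j m))
        has_sum jac x * psi x + psi x * jac x) UNIV"
      unfolding jac_def psi_def using s
      by (intro has_sum_add has_sum_product_complex[of _ UNIV _ UNIV, simplified])
    show "(case (k + l, k - l) of (n, m) \<Rightarrow> ?j n * ?p m) + (case (k + l, k - l) of (n, m) \<Rightarrow> ?p n * ?j m)
       = 2 * (of_int (4 * k + 1) * x\<^sup>2 powi (2 * k\<^sup>2 + k)) * (-x) powi (2 * l)\<^sup>2" for k l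
    proof -
      have "?p (k + l) * ?p (k - l) = x\<^sup>2 powi (2 * k\<^sup>2 + k) * (-x) powi (2 * l)\<^sup>2"
        using x unfolding powi_sq power_int_minus_left
        by (simp flip: power_int_add) (intro powi_cong, simp add: power2_eq_square algebra_simps)
      then show ?thesis by (simp add: algebra_simps)
    qed
    show "(case (l - k, - k - l - 1) of (n, m) \<Rightarrow> ?j n * ?p m) + (case (l - k, - k - l - 1) of (n, m) \<Rightarrow> ?p n * ?j m)
       = 2 * (of_int (4 * k + 1) * x\<^sup>2 powi (2 * k\<^sup>2 + k)) * (-x) powi (2 * l + 1)\<^sup>2" for k l
    proof -
      have "?p (l - k) * ?p (- k - l - 1) = - (x\<^sup>2 powi (2 * k\<^sup>2 + k) * (-x) powi (2 * l + 1)\<^sup>2)"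
        using x unfolding powi_sq power_int_minus_left
        by (simp flip: power_int_add) (intro powi_cong, simp add: power2_eq_square algebra_simps)
      then show ?thesis by (simp add: algebra_simps)
    qed
  qed (use x norm_power_nome in \<open>auto intro!: summable_intros summable_on_cmult_right simp del: of_int_add\<close>)
  then show ?thesis by (simp add: infsum_cmult_right' jac_def mult.commute)
qed

text \<open>
In terms of the odd numbers \<open>8n + 3\<close> and \<open>8m + 1\<close>, the exponents involve their squares, the
sum is \<open>4(2(n + m) + 1)\<close> and the difference is \<open>2(4(n - m) + 1)\<close>. The product therefore splits
into a series of nome \<open>x^4\<close> and one of nome \<open>x\<close>, and its symmetric and antisymmetric
derivatives put the weight on one factor each.
\<close>

lemma octant_mult: "octant 1 x * octant 3 x = psi (x^4) * psi x"
  and octant_wronskian: "octant 1 x * octant' 3 x - octant' 1 x * octant 3 x = 2 * psi (x^4) * jac x"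
  and octant_product_deriv: "octant 1 x * octant' 3 x + octant' 1 x * octant 3 x = 4 * jac (x^4) * psi (-x)"
proof -
  let ?a = "\<lambda>n. x powi (4 * n\<^sup>2 + 1 * n)" and ?a' = "\<lambda>n. of_int (8 * n + 1) * x powi (4 * n\<^sup>2 + 1 * n)"
  let ?b = "\<lambda>n. x powi (4 * n\<^sup>2 + 3 * n)" and ?b' = "\<lambda>n. of_int (8 * n + 3) * x powi (4 * n\<^sup>2 + 3 * n)"
  have s: "?a summable_on UNIV" "?a' summable_on UNIV" "?b summable_on UNIV" "?b' summable_on UNIV"
    unfolding mult_1 by (intro summable_intros x)+
  have even: "?b (k + l) * ?a (k - l) = (x^4) powi (2 * k\<^sup>2 + k) * x powi (2 * (2 * l)\<^sup>2 + 2 * l)" for k l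
    using x unfolding powi_sq
    by (simp flip: power_int_add) (intro powi_cong, simp add: power2_eq_square algebra_simps)
  have odd: "?b (l - k) * ?a (- k - l - 1)
      = (x^4) powi (2 * k\<^sup>2 + k) * x powi (2 * (2 * l + 1)\<^sup>2 + (2 * l + 1))" for k l
    using x unfolding powi_sq
    by (simp flip: power_int_add) (intro powi_cong, simp add: power2_eq_square algebra_simps)

  have "octant 3 x * octant 1 x = psi (x^4) * psi x"
    unfolding psi_def
  proof (rule folded_reindex_infsum)
    show "((\<lambda>(n, m). ?b n * ?a m) has_sum octant 3 x * octant 1 x) UNIV"
      unfolding octant_def using s by (intro has_sum_product_complex[of _ UNIV _ UNIV, simplified])
  qed (use x norm_power_nome even odd in \<open>auto intro!: summable_intros\<close>)
  then show "octant 1 x * octant 3 x = psi (x^4) * psi x" by (simp add: mult.commute)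

  have "octant' 3 x * octant 1 x - octant 3 x * octant' 1 x = psi (x^4) * (\<Sum>\<^sub>\<infinity>j. 2 * (of_int (4 * j + 1) * x powi (2 * j\<^sup>2 + j)))"
    unfolding psi_def
  proof (rule folded_reindex_infsum)
    show "((\<lambda>p. (case p of (n, m) \<Rightarrow> ?b' n * ?a m) + - (case p of (n, m) \<Rightarrow> ?b n * ?a' m))
        has_sum octant' 3 x * octant 1 x - octant 3 x * octant' 1 x) UNIV"
      unfolding octant_def octant'_def diff_conv_add_uminus using s
      by (intro has_sum_add has_sum_uminusI has_sum_product_complex[of _ UNIV _ UNIV, simplified])
    show "(case (k + l, k - l) of (n, m) \<Rightarrow> ?b' n * ?a m) + - (case (k + l, k - l) of (n, m) \<Rightarrow> ?b n * ?a' m)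
       = (x^4) powi (2 * k\<^sup>2 + k) * (2 * (of_int (4 * (2 * l) + 1) * x powi (2 * (2 * l)\<^sup>2 + 2 * l)))" for k l
    proof -
      have "?b' (k + l) * ?a (k - l) + - (?b (k + l) * ?a' (k - l))
          = 2 * of_int (4 * (2 * l) + 1) * (?b (k + l) * ?a (k - l))"
        by (simp add: ring_distribs)
      then show ?thesis unfolding even prod.case by (simp only: mult_ac)
    qed
    show "(case (l - k, - k - l - 1) of (n, m) \<Rightarrow> ?b' n * ?a m) + - (case (l - k, - k - l - 1) of (n, m) \<Rightarrow> ?b n * ?a' m)
       = (x^4) powi (2 * k\<^sup>2 + k) * (2 * (of_int (4 * (2 * l + 1) + 1) * x powi (2 * (2 * l + 1)\<^sup>2 + (2 * l + 1))))" for k l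
    proof -
      have "?b' (l - k) * ?a (- k - l - 1) + - (?b (l - k) * ?a' (- k - l - 1))
          = 2 * of_int (4 * (2 * l + 1) + 1) * (?b (l - k) * ?a (- k - l - 1))"
        by (simp add: ring_distribs)
      then show ?thesis unfolding odd prod.case by (simp only: mult_ac)
    qed
  qed (use x norm_power_nome in \<open>auto intro!: summable_intros summable_on_cmult_right simp del: of_int_add\<close>)
  then show "octant 1 x * octant' 3 x - octant' 1 x * octant 3 x = 2 * psi (x^4) * jac x"
    by (simp add: infsum_cmult_right' jac_def mult.commute)

  have "octant' 3 x * octant 1 x + octant 3 x * octant' 1 x
      = (\<Sum>\<^sub>\<infinity>k. 4 * (of_int (4 * k + 1) * (x^4) powi (2 * k\<^sup>2 + k))) * psi (-x)"
    unfolding psi_def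
  proof (rule folded_reindex_infsum)
    show "((\<lambda>p. (case p of (n, m) \<Rightarrow> ?b' n * ?a m) + (case p of (n, m) \<Rightarrow> ?b n * ?a' m))
        has_sum octant' 3 x * octant 1 x + octant 3 x * octant' 1 x) UNIV"
      unfolding octant_def octant'_def using s
      by (intro has_sum_add has_sum_product_complex[of _ UNIV _ UNIV, simplified])
    show "(case (k + l, k - l) of (n, m) \<Rightarrow> ?b' n * ?a m) + (case (k + l, k - l) of (n, m) \<Rightarrow> ?b n * ?a' m)
       = 4 * (of_int (4 * k + 1) * (x^4) powi (2 * k\<^sup>2 + k)) * (-x) powi (2 * (2 * l)\<^sup>2 + 2 * l)" for k l
    proof -
      have "?b' (k + l) * ?a (k - l) + ?b (k + l) * ?a' (k - l)
          = 4 * of_int (4 * k + 1) * (?b (k + l) * ?a (k - l))"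
        by (simp add: ring_distribs)
      then show ?thesis unfolding even prod.case by (simp add: power_int_minus_left)
    qed
    show "(case (l - k, - k - l - 1) of (n, m) \<Rightarrow> ?b' n * ?a m) + (case (l - k, - k - l - 1) of (n, m) \<Rightarrow> ?b n * ?a' m)
       = 4 * (of_int (4 * k + 1) * (x^4) powi (2 * k\<^sup>2 + k)) * (-x) powi (2 * (2 * l + 1)\<^sup>2 + (2 * l + 1))" for k l
    proof -
      have "?b' (l - k) * ?a (- k - l - 1) + ?b (l - k) * ?a' (- k - l - 1)
          = - (4 * of_int (4 * k + 1) * (?b (l - k) * ?a (- k - l - 1)))"
        by (simp add: ring_distribs)
      then show ?thesis unfolding odd prod.case by (simp add: power_int_minus_left)
    qed
  qed (use x norm_power_nome in \<open>auto intro!: summable_intros summable_on_cmult_right simp del: of_int_add\<close>)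
  then show "octant 1 x * octant' 3 x + octant' 1 x * octant 3 x = 4 * jac (x^4) * psi (-x)"
    by (simp add: infsum_cmult_right' jac_def mult.commute)
qed

end

section \<open>Descent along iterated squares of the nome\<close>

text \<open>
The iterated squares of \<open>x\<close> tend to \<open>0\<close>, so \<open>P\<close> holds at one of them and can be
pulled back from there to \<open>x\<close>.
\<close>

lemma eventually_at_0_descend_squaring:
  fixes x :: complex
  assumes P: "eventually P (at 0)" and step: "\<And>y. y \<noteq> 0 \<Longrightarrow> norm y < 1 \<Longrightarrow> P (y\<^sup>2) \<Longrightarrow> P y"
    and x: "x \<noteq> 0" "norm x < 1"
  shows "P x"
proof -
  have "(\<lambda>n. x ^ n) \<longlonglongrightarrow> 0"
    using x by (intro LIMSEQ_power_zero)
  then have "(\<lambda>k. x ^ 2 ^ k) \<longlonglongrightarrow> 0"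
    by (rule LIMSEQ_subseq_LIMSEQ[unfolded o_def]) (simp add: strict_mono_def)
  then have "filterlim (\<lambda>k. x ^ 2 ^ k) (at 0) sequentially"
    using x by (simp add: filterlim_at)
  then have "eventually (\<lambda>k. P (x ^ 2 ^ k)) sequentially"
    using P by (rule eventually_compose_filterlim[rotated])
  then obtain k where k: "P (x ^ 2 ^ k)"
    by (auto simp: eventually_sequentially)
  have "P (x ^ 2 ^ k) \<Longrightarrow> P x" for k
  proof (induction k)
    case (Suc k)
    have "norm (x ^ 2 ^ k) < 1"
      using x by (simp add: norm_power power_less_one_iff)
    moreover have "x ^ 2 ^ Suc k = (x ^ 2 ^ k)\<^sup>2"
      by (simp flip: power_mult add: mult.commute)
    ultimately show ?case using Suc x step[of "x ^ 2 ^ k"] by simp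
  qed simp
  from this[OF k] show ?thesis .
qed

lemma squaring_invariant_eq_limit:
  fixes R :: "complex \<Rightarrow> complex"
  assumes lim: "(R \<longlongrightarrow> l) (at 0)" and inv: "\<And>y. y \<noteq> 0 \<Longrightarrow> norm y < 1 \<Longrightarrow> R (y\<^sup>2) = R y"
    and x: "x \<noteq> 0" "norm x < 1"
  shows "R x = l"
proof (rule ccontr)
  assume "R x \<noteq> l"
  then have "dist (R x) l > 0" by simp
  with lim have "eventually (\<lambda>y. dist (R y) l < dist (R x) l) (at 0)"
    by (rule tendstoD)
  then have "dist (R x) l < dist (R x) l"
    by (rule eventually_at_0_descend_squaring[OF _ _ x]) (simp add: inv)
  then show False by simp
qed

lemma phi_tendsto_1: "(phi \<longlongrightarrow> 1) (at 0)"
  and psi_tendsto_1: "(psi \<longlongrightarrow> 1) (at 0)"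
  and jac_tendsto_1: "(jac \<longlongrightarrow> 1) (at 0)"
  using tendsto_linear_powi_series[of "\<lambda>n. n\<^sup>2" 0 1]
    tendsto_linear_powi_series[of "\<lambda>n. 2 * n\<^sup>2 + n" 0 1]
    tendsto_linear_powi_series[of "\<lambda>n. 2 * n\<^sup>2 + n" 4 1]
  by (simp_all add: quadratic_exponent_bounds phi_def[abs_def] psi_def[abs_def] jac_def[abs_def])

lemma tendsto_1_compose:
  fixes f g :: "complex \<Rightarrow> complex"
  assumes "(f \<longlongrightarrow> 1) (at 0)" and "(g \<longlongrightarrow> 0) (at 0)" "\<And>y. y \<noteq> 0 \<Longrightarrow> g y \<noteq> 0"
  shows "((\<lambda>y. f (g y)) \<longlongrightarrow> 1) (at 0)"
  using assms(2,3) by (intro filterlim_compose[OF assms(1)]) (auto simp: filterlim_at eventually_at_filter)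

lemma phi_neg_tendsto_1: "((\<lambda>x. phi (-x)) \<longlongrightarrow> 1) (at 0)"
  and psi_neg_tendsto_1: "((\<lambda>x. psi (-x)) \<longlongrightarrow> 1) (at 0)"
  and phi_neg_sq_tendsto_1: "((\<lambda>x. phi (-(x\<^sup>2))) \<longlongrightarrow> 1) (at 0)"
proof -
  have "((\<lambda>x::complex. - x) \<longlongrightarrow> 0) (at 0)" "((\<lambda>x::complex. - (x\<^sup>2)) \<longlongrightarrow> 0) (at 0)"
    by (auto intro!: tendsto_eq_intros)
  then show "((\<lambda>x. phi (-x)) \<longlongrightarrow> 1) (at 0)" "((\<lambda>x. psi (-x)) \<longlongrightarrow> 1) (at 0)"
    "((\<lambda>x. phi (-(x\<^sup>2))) \<longlongrightarrow> 1) (at 0)"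
    using tendsto_1_compose[OF phi_tendsto_1, of "\<lambda>x. - x"] tendsto_1_compose[OF psi_tendsto_1, of "\<lambda>x. - x"]
    tendsto_1_compose[OF phi_tendsto_1, of "\<lambda>x. - (x\<^sup>2)"]
    by simp_all
qed

text \<open>
The difference of the squares of the even and the odd part of \<open>\<phi>\<close>, read in two ways.
\<close>

lemma phi_neg_sq:
  assumes x: "x \<noteq> 0" "norm x < 1"
  shows "phi (-(x\<^sup>2)) ^ 2 = phi x * phi (-x)"
proof -
  have "phi x = phi_even x + phi_odd x" "phi (-x) = phi_even x - phi_odd x"
    using phi_split[of x] phi_split[of "-x"] x by (simp_all add: phi_even_neg phi_odd_neg)
  then show ?thesis
    by (simp only: sq_phi_neg[OF x]) (simp add: power2_eq_square algebra_simps)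
qed

text \<open>
By \<open>phi_neg_sq\<close> a zero of \<open>\<phi>(-y)\<close> is a zero of \<open>\<phi>(-y^2)\<close>; hence zeros would accumulate at
\<open>0\<close>, where \<open>\<phi>\<close> tends to \<open>1\<close>.
\<close>

lemma phi_nonzero:
  assumes x: "x \<noteq> 0" "norm x < 1"
  shows "phi x \<noteq> 0"
proof -
  have "phi (- (-x)) \<noteq> 0"
  proof (rule eventually_at_0_descend_squaring[where P = "\<lambda>y. phi (-y) \<noteq> 0"])
    show "eventually (\<lambda>y. phi (-y) \<noteq> 0) (at 0)"
      by (rule tendsto_imp_eventually_ne[OF phi_neg_tendsto_1]) simp
    show "phi (-y) \<noteq> 0" if "y \<noteq> 0" "norm y < 1" "phi (-(y\<^sup>2)) \<noteq> 0" for y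
      using phi_neg_sq[OF that(1,2)] that(3) by auto
  qed (use x in auto)
  then show ?thesis by simp
qed

lemma psi_nonzero:
  assumes x: "x \<noteq> 0" "norm x < 1"
  shows "psi x \<noteq> 0"
proof (rule eventually_at_0_descend_squaring[OF _ _ x])
  show "eventually (\<lambda>y. psi y \<noteq> 0) (at 0)"
    by (rule tendsto_imp_eventually_ne[OF psi_tendsto_1]) simp
  show "psi y \<noteq> 0" if "y \<noteq> 0" "norm y < 1" "psi (y\<^sup>2) \<noteq> 0" for y
    using psi_sq[OF that(1,2)] phi_nonzero[OF that(1,2)] that(3) by auto
qed

text \<open>
Jacobi's formula for \<open>\<theta>[1, 1]'(\<tau>, 0)\<close> as a product of three theta constants. The quotient of the
two sides is invariant under squaring the nome, by \<open>jac_psi\<close> on the left and \<open>psi_sq\<close> and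
\<open>phi_neg_sq\<close> on the right.
\<close>

lemma jacobi_derivative:
  assumes x: "x \<noteq> 0" "norm x < 1"
  shows "jac x = psi x * phi (-x) ^ 2"
proof -
  define R where "R y = jac y / (psi y * phi (-y) ^ 2)" for y
  have "R x = 1"
  proof (rule squaring_invariant_eq_limit[OF _ _ x])
    have "((\<lambda>y. jac y / (psi y * phi (-y) ^ 2)) \<longlongrightarrow> 1 / (1 * 1 ^ 2)) (at 0)"
      by (intro tendsto_intros jac_tendsto_1 psi_tendsto_1 phi_neg_tendsto_1) auto
    then show "(R \<longlongrightarrow> 1) (at 0)" by (simp add: R_def[abs_def])
    fix y :: complex assume y: "y \<noteq> 0" "norm y < 1"
    have y': "y\<^sup>2 \<noteq> 0" "norm (y\<^sup>2) < 1" "-y \<noteq> 0" "norm (-y) < 1" "-(y\<^sup>2) \<noteq> 0" "norm (-(y\<^sup>2)) < 1"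
      using y norm_power_nome[OF y] by auto
    note nz = psi_nonzero[OF y] phi_nonzero[OF y] psi_nonzero[OF y'(1,2)] phi_nonzero[OF y'(3,4)] phi_nonzero[OF y'(5,6)]
    have "jac (y\<^sup>2) * (psi y * phi (-y) ^ 2) = (jac (y\<^sup>2) * phi (-y)) * psi y * phi (-y)"
      by (simp add: power2_eq_square)
    also have "\<dots> = jac y * psi y ^ 2 * phi (-y)"
      unfolding jac_psi[OF y, symmetric] by (simp add: power2_eq_square)
    also have "\<dots> = jac y * (psi (y\<^sup>2) * phi (-(y\<^sup>2)) ^ 2)"
      unfolding psi_sq[OF y] phi_neg_sq[OF y] by simp
    finally show "R (y\<^sup>2) = R y" unfolding R_def using nz by (simp add: frac_eq_eq)
  qed
  with x psi_nonzero[OF x] phi_nonzero[of "-x"] show ?thesis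
    by (simp add: R_def)
qed

text \<open>
The squares of the two sides agree by \<open>phi_neg_sq\<close> and \<open>psi_sq\<close>, but this leaves a sign open. The
descent decides it: \<open>psi_psi_neg\<close> makes the quotient invariant under squaring the nome.
\<close>

lemma phi_psi_reflect:
  assumes x: "x \<noteq> 0" "norm x < 1"
  shows "phi (-(x\<^sup>2)) * psi (-x) = phi (-x) * psi x"
proof -
  define R where "R y = phi (-(y\<^sup>2)) * psi (-y) / (phi (-y) * psi y)" for y
  have "R x = 1"
  proof (rule squaring_invariant_eq_limit[OF _ _ x])
    have "((\<lambda>y. phi (-(y\<^sup>2)) * psi (-y) / (phi (-y) * psi y)) \<longlongrightarrow> 1 * 1 / (1 * 1)) (at 0)"
      by (intro tendsto_intros psi_tendsto_1 phi_neg_tendsto_1 psi_neg_tendsto_1 phi_neg_sq_tendsto_1) auto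
    then show "(R \<longlongrightarrow> 1) (at 0)" by (simp add: R_def[abs_def])
    fix y :: complex assume y: "y \<noteq> 0" "norm y < 1"
    have y': "y\<^sup>2 \<noteq> 0" "norm (y\<^sup>2) < 1" "-y \<noteq> 0" "norm (-y) < 1" "-(y\<^sup>2) \<noteq> 0" "norm (-(y\<^sup>2)) < 1"
      using y norm_power_nome[OF y] by auto
    note nz = psi_nonzero[OF y] phi_nonzero[OF y] psi_nonzero[OF y'(1,2)] phi_nonzero[OF y'(3,4)] phi_nonzero[OF y'(5,6)]
    have "phi (-(y^4)) * psi (-(y\<^sup>2)) * (phi (-y) * psi y) = psi y ^ 2 * psi (-y) * phi (-y)"
      using psi_psi_neg[OF y] by (simp add: power2_eq_square mult_ac)
    also have "\<dots> = phi (-(y\<^sup>2)) ^ 2 * psi (-y) * psi (y\<^sup>2)"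
      unfolding psi_sq[OF y] phi_neg_sq[OF y] by (simp add: mult_ac)
    finally have "phi (-(y^4)) * psi (-(y\<^sup>2)) * (phi (-y) * psi y)
        = phi (-(y\<^sup>2)) * psi (-y) * (phi (-(y\<^sup>2)) * psi (y\<^sup>2))"
      by (simp add: power2_eq_square mult_ac)
    with nz show "R (y\<^sup>2) = R y"
      unfolding R_def by (simp add: frac_eq_eq flip: power_mult)
  qed
  with x psi_nonzero[OF x] phi_nonzero[of "-x"] show ?thesis
    by (simp add: R_def)
qed

text \<open>
The sum and the difference of the two logarithmic derivatives, each multiplied by
\<open>A\<^sub>1A\<^sub>3\<close>, are known from \<open>octant_product_deriv\<close> and \<open>octant_wronskian\<close>.
\<close>

theorem octant_log_derivative:
  assumes x: "x \<noteq> 0" "norm x < 1"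
  shows "octant' 1 x = octant 1 x * (phi (-x) * (2 * phi (x\<^sup>2) - phi (-x)))"
    and "octant' 3 x = octant 3 x * (phi (-x) * (2 * phi (x\<^sup>2) + phi (-x)))"
proof -
  have x': "x ^ 4 \<noteq> 0" "norm (x ^ 4) < 1" "x\<^sup>2 \<noteq> 0" "norm (x\<^sup>2) < 1"
    using x norm_power_nome[OF x] by auto
  have nz: "octant 1 x \<noteq> 0" "octant 3 x \<noteq> 0"
    using octant_mult[OF x] psi_nonzero[OF x] psi_nonzero[OF x'(1,2)] by auto
  have w: "octant 1 x * octant' 3 x - octant' 1 x * octant 3 x = 2 * phi (-x) ^ 2 * (octant 1 x * octant 3 x)"
    unfolding octant_wronskian[OF x] octant_mult[OF x] jacobi_derivative[OF x] by simp
  have "octant 1 x * octant' 3 x + octant' 1 x * octant 3 x = 4 * psi (x^4) * phi (-((x\<^sup>2)\<^sup>2)) ^ 2 * psi (-x)"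
    unfolding octant_product_deriv[OF x] jacobi_derivative[OF x'(1,2)] by (simp flip: power_mult)
  also have "\<dots> = 4 * psi (x^4) * phi (x\<^sup>2) * (phi (-(x\<^sup>2)) * psi (-x))"
    unfolding phi_neg_sq[OF x'(3,4)] by simp
  also have "\<dots> = 4 * phi (-x) * phi (x\<^sup>2) * (octant 1 x * octant 3 x)"
    unfolding phi_psi_reflect[OF x] octant_mult[OF x] by simp
  finally have p: "octant 1 x * octant' 3 x + octant' 1 x * octant 3 x = 4 * phi (-x) * phi (x\<^sup>2) * (octant 1 x * octant 3 x)" .
  have "2 * octant 3 x * octant' 1 x = 2 * octant 3 x * (octant 1 x * (phi (-x) * (2 * phi (x\<^sup>2) - phi (-x))))"
    using arg_cong2[where f = "(-)", OF p w] by (simp add: algebra_simps power2_eq_square)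
  then show "octant' 1 x = octant 1 x * (phi (-x) * (2 * phi (x\<^sup>2) - phi (-x)))"
    using nz by simp
  have "2 * octant 1 x * octant' 3 x = 2 * octant 1 x * (octant 3 x * (phi (-x) * (2 * phi (x\<^sup>2) + phi (-x))))"
    using arg_cong2[where f = "(+)", OF p w] by (simp add: algebra_simps power2_eq_square)
  then show "octant' 3 x = octant 3 x * (phi (-x) * (2 * phi (x\<^sup>2) + phi (-x)))"
    using nz by simp
qed

section \<open>Theta constants as series in the nome\<close>

lemma ee_add: "ee (u + v) = ee u * ee v"
  by (simp add: ee_def ring_distribs exp_add)

lemma ee_powi: "ee u powi n = ee (of_int n * u)"
  by (simp add: ee_def exp_power_int mult_ac)

lemma norm_ee_le: "norm (ee u) \<le> exp (2 * pi * norm u)"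
proof -
  have "norm (ee u) = exp (- (2 * pi * Im u))" by (simp add: ee_def)
  also have "\<dots> \<le> exp (2 * pi * norm u)"
    using mult_left_mono[of "- Im u" "norm u" "2 * pi"] abs_Im_le_cmod[of u] by simp
  finally show ?thesis .
qed

lemma ee_values: "ee 0 = 1" "ee (1 / 2) = -1" "ee (1 / 4) = \<i>" "ee (3 / 4) = - \<i>"
proof -
  show "ee 0 = 1" by (simp add: ee_def)
  have "ee (1 / 2) = exp (\<i> * of_real pi)" by (simp add: ee_def mult_ac)
  then show h: "ee (1 / 2) = -1" by simp
  have "ee (1 / 4) = cis (pi / 2)" by (simp add: ee_def cis_conv_exp mult_ac)
  then show q: "ee (1 / 4) = \<i>" by simp
  have "ee (3 / 4) = ee (1 / 2) * ee (1 / 4)" by (simp flip: ee_add)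
  with h q show "ee (3 / 4) = - \<i>" by simp
qed

lemma theta_00: "theta 0 0 \<tau> 0 = phi (ee (\<tau> / 2))"
  by (simp add: theta_def phi_def ee_powi)

lemma theta_01: "theta 0 1 \<tau> 0 = phi (- ee (\<tau> / 2))"
  unfolding theta_def phi_def
proof (rule infsum_cong)
  fix n :: int
  have "(- ee (\<tau> / 2)) powi n\<^sup>2 = (-1) powi n * ee (\<tau> / 2) powi n\<^sup>2"
    by (simp add: power_int_minus_left)
  also have "\<dots> = ee (of_int n ^ 2 * (\<tau> / 2) + of_int n * (1 / 2))"
    unfolding ee_values(2)[symmetric] ee_powi ee_add by simp
  finally show "ee ((of_int n + of_real 0 / 2)\<^sup>2 * (\<tau> / 2) + (of_int n + of_real 0 / 2) * (0 + of_real 1 / 2)) =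
          (- ee (\<tau> / 2)) powi n\<^sup>2" by simp
qed

lemma theta_10: "theta 1 0 \<tau> 0 = phi_odd (ee (\<tau> / 8))"
  unfolding theta_def phi_odd_def
proof (rule infsum_reindex_bij_witness[where i = "\<lambda>n. n div 2" and j = "\<lambda>n. 2 * n + 1"])
  fix n :: int
  show "ee (\<tau> / 8) powi (2 * n + 1)\<^sup>2
      = ee ((of_int n + of_real 1 / 2)\<^sup>2 * (\<tau> / 2) + (of_int n + of_real 1 / 2) * (0 + of_real 0 / 2))"
    unfolding ee_powi by (rule arg_cong[where f = ee]) (simp add: power2_eq_square field_simps)
qed auto

lemma ee_nome:
  assumes "Im \<tau> > 0" "c > 0"
  shows "ee (\<tau> / of_real c) \<noteq> 0" "norm (ee (\<tau> / of_real c)) < 1"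
  using assms by (simp_all add: ee_def)

text \<open>
The square of a series over half-integers: the sum and the difference of two half-integers are
integers of opposite parity, hence the product of the even and the odd part of
\<open>\<phi>\<close>.
\<close>

lemma theta_10_half_sq:
  assumes "Im \<tau> > 0"
  shows "theta 1 0 (\<tau> / 2) 0 ^ 2 = 2 * theta 0 0 \<tau> 0 * theta 1 0 \<tau> 0"
proof -
  define x where "x = ee (\<tau> / 8)"
  have x: "x \<noteq> 0" "norm x < 1"
    using ee_nome[OF assms, of 8] by (auto simp: x_def)
  define t where "t n = ee (\<tau> / 16) * x powi (2 * n\<^sup>2 + 2 * n)" for n :: int
  have t: "t n = ee ((of_int n + 1 / 2)\<^sup>2 * (\<tau> / 4))" for n
    unfolding t_def x_def ee_powi ee_add[symmetric]
    by (rule arg_cong[where f = ee]) (simp add: power2_eq_square field_simps)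
  have "theta 1 0 (\<tau> / 2) 0 = infsum t UNIV"
    unfolding theta_def by (rule infsum_cong) (simp add: t)
  also have "infsum t UNIV * infsum t UNIV = phi_odd x * phi_even x + phi_even x * phi_odd x"
    unfolding phi_even_def phi_odd_def
  proof (rule parity_opposite_infsum)
    show "t summable_on UNIV"
      unfolding t_def
      by (intro summable_on_cmult_right summable_on_powi x quadratic_exponent_bounds(5))
    then show "t summable_on UNIV" .
    show "(\<lambda>n. x powi n\<^sup>2) summable_on UNIV"
      using x by (intro summable_intros)
    then show "(\<lambda>n. x powi n\<^sup>2) summable_on UNIV" .
    show "t s * t d = x powi (s + d + 1)\<^sup>2 * x powi (s - d)\<^sup>2" for s d
      unfolding t x_def ee_powi ee_add[symmetric]
      by (rule arg_cong[where f = ee]) (simp add: power2_eq_square field_simps)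
  qed
  finally show ?thesis
    using phi_even_eq[OF x] by (simp add: theta_00 theta_10 x_def power2_eq_square ee_powi[of _ 4, simplified])
qed

lemma norm_fourth_root_of_unity: "norm \<iota> = 1" if "\<iota> ^ 4 = 1" for \<iota> :: complex
proof -
  have "norm \<iota> ^ 4 = 1 ^ 4" using that by (metis norm_one norm_power power_one)
  then show ?thesis by (subst (asm) power_eq_iff_eq_base) auto
qed

text \<open>
Expanding the square, the exponent of the \<open>n\<close>th term is \<open>(4n^2 + an) \<tau>/8 + n\<delta>/2\<close> up to a
constant. Since \<open>\<iota>^4 = 1\<close>, the power \<open>\<iota>^(4n^2 + an)\<close> is \<open>(\<iota>^a)^n\<close>, so that the phase
\<open>e(n\<delta>/2)\<close> can be moved into the nome.
\<close>

lemma theta_eighth: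
  fixes a :: int and \<iota> \<tau> :: complex and \<delta> :: real
  assumes \<tau>: "Im \<tau> > 0" and a: "a = 1 \<or> a = 3"
    and \<iota>: "\<iota> ^ 4 = 1" "\<iota> powi a = ee (of_real \<delta> / 2)"
  defines "X \<equiv> \<iota> * ee (\<tau> / 8)" and "K \<equiv> ee (of_int a ^ 2 * \<tau> / 128 + of_int a * of_real \<delta> / 16)"
  shows "theta (of_int a / 4) \<delta> \<tau> 0 = K * octant a X"
    and "theta' (of_int a / 4) \<delta> \<tau> 0 = K * (of_real pi * \<i> / 4 * octant' a X)"
proof -
  have \<iota>0: "\<iota> \<noteq> 0" using \<iota>(1) by auto
  have n\<iota>: "norm \<iota> = 1" using \<iota>(1) by (rule norm_fourth_root_of_unity)
  have nX: "norm X = exp (- (pi * Im \<tau> / 4))"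
    by (simp add: X_def norm_mult n\<iota> ee_def)
  have X: "X \<noteq> 0" "norm X < 1"
    using \<iota>0 \<tau> nX by (auto simp: X_def ee_def)
  define t where "t n z = X powi (4 * n\<^sup>2 + a * n) * ee ((of_int n + of_int a / 8) * z)" for n z
  have term_eq: "ee ((of_int n + of_real (of_int a / 4) / 2) ^ 2 * (\<tau> / 2)
           + (of_int n + of_real (of_int a / 4) / 2) * (z + of_real \<delta> / 2)) = K * t n z" for n z
  proof -
    have "\<iota> powi (4 * n\<^sup>2 + a * n) = (\<iota> powi a) powi n"
      using \<iota>(1) \<iota>0 by (simp add: power_int_add power_int_mult)
    also have "\<dots> = ee (of_int n * (of_real \<delta> / 2))"
      unfolding \<iota>(2) by (rule ee_powi)
    finally have "X powi (4 * n\<^sup>2 + a * n)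
        = ee (of_int n * (of_real \<delta> / 2)) * ee (of_int (4 * n\<^sup>2 + a * n) * (\<tau> / 8))"
      unfolding X_def power_int_mult_distrib ee_powi by simp
    then show ?thesis
      unfolding t_def K_def ee_add[symmetric] mult.assoc[symmetric]
      by (simp only: ee_add[symmetric] mult.assoc)
         (rule arg_cong[where f = ee], simp add: power2_eq_square field_simps)
  qed
  have theta_eq: "theta (of_int a / 4) \<delta> \<tau> z = K * (\<Sum>\<^sub>\<infinity>n. t n z)" for z
    unfolding theta_def term_eq by (rule infsum_cmult_right')
  then show "theta (of_int a / 4) \<delta> \<tau> 0 = K * octant a X"
    by (simp add: t_def octant_def ee_values)

  have deriv_term: "2 * of_real pi * \<i> * (of_int n + of_int a / 8) * t n 0
      = of_real pi * \<i> / 4 * (of_int (8 * n + a) * X powi (4 * n\<^sup>2 + a * n))" for n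
    by (simp add: t_def ee_values field_simps)
  have "((\<lambda>z. \<Sum>\<^sub>\<infinity>n. t n z) has_field_derivative
      (\<Sum>\<^sub>\<infinity>n. 2 * of_real pi * \<i> * (of_int n + of_int a / 8) * t n 0)) (at 0)"
  proof (rule has_field_derivative_infsum)
    show "(t n has_field_derivative 2 * of_real pi * \<i> * (of_int n + of_int a / 8) * t n z) (at z)" for n z
      unfolding t_def ee_def by (auto intro!: derivative_eq_intros)
    \<comment> \<open>On the disc of this radius, \<open>e((n + a/8)z)\<close> grows at most like \<open>norm X powi (- \<bar>n\<bar> - 1)\<close>,
      which leaves a quadratic exponent.\<close>
    show "0 < Im \<tau> / 8" using \<tau> by simp
    have "\<bar>n\<bar> \<le> (4 * n\<^sup>2 + a * n - \<bar>n\<bar>) + 1" for n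
    proof -
      have "0 \<le> (\<bar>n\<bar> - 1) * (4 * \<bar>n\<bar> - 1)"
        by (cases "n = 0") auto
      then have "5 * \<bar>n\<bar> \<le> 4 * n\<^sup>2 + 1"
        by (simp add: algebra_simps power2_eq_square)
      then show ?thesis using a by auto
    qed
    then have "(\<lambda>n. X powi (4 * n\<^sup>2 + a * n - \<bar>n\<bar>)) summable_on UNIV"
      by (rule summable_on_powi[OF X])
    then show "(\<lambda>n. norm (X powi (4 * n\<^sup>2 + a * n - \<bar>n\<bar>)) / norm X) summable_on UNIV"
      unfolding divide_inverse summable_on_iff_abs_summable_on_complex
      by (rule summable_on_cmult_left)
    show "norm (t n z) \<le> norm (X powi (4 * n\<^sup>2 + a * n - \<bar>n\<bar>)) / norm X"
      if "norm (z - 0) \<le> Im \<tau> / 8" for n z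
    proof -
      have "norm (of_int n + of_int a / 8 :: complex) \<le> norm (of_int n :: complex) + norm (of_int a / 8 :: complex)"
        by (rule norm_triangle_ineq)
      also have "\<dots> \<le> \<bar>of_int n\<bar> + 1" using a by auto
      finally have "norm ((of_int n + of_int a / 8) * z) \<le> (\<bar>of_int n\<bar> + 1) * (Im \<tau> / 8)"
        unfolding norm_mult using that by (intro mult_mono) auto
      then have "norm (ee ((of_int n + of_int a / 8) * z)) \<le> exp (2 * pi * ((\<bar>of_int n\<bar> + 1) * (Im \<tau> / 8)))"
        by (intro order_trans[OF norm_ee_le]) (simp add: mult.commute)
      also have "\<dots> = norm X powi (- \<bar>n\<bar> - 1)"
        unfolding nX exp_power_int by (simp add: field_simps)
      finally have "norm (t n z) \<le> norm X powi (4 * n\<^sup>2 + a * n) * norm X powi (- \<bar>n\<bar> - 1)"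
        unfolding t_def norm_mult norm_power_int by (intro mult_left_mono) auto
      also have "\<dots> = norm X powi (4 * n\<^sup>2 + a * n - \<bar>n\<bar>) / norm X"
        using X by (simp add: power_int_add power_int_diff power_int_minus field_simps)
      finally show ?thesis by (simp add: norm_power_int)
    qed
    have "(\<lambda>n. of_real pi * \<i> / 4 * (of_int (8 * n + a) * X powi (4 * n\<^sup>2 + a * n))) summable_on UNIV"
      using a by (intro summable_on_cmult_right summable_on_linear_powi X)
        (auto intro: quadratic_exponent_bounds[THEN le_Suc_int])
    then show "(\<lambda>n. 2 * of_real pi * \<i> * (of_int n + of_int a / 8) * t n 0) summable_on UNIV"
      unfolding deriv_term .
  qed
  also have "(\<Sum>\<^sub>\<infinity>n. 2 * of_real pi * \<i> * (of_int n + of_int a / 8) * t n 0) = of_real pi * \<i> / 4 * octant' a X"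
    unfolding octant'_def infsum_cmult_right'[symmetric]
    by (rule infsum_cong) (rule deriv_term)
  finally have "((\<lambda>z. K * (\<Sum>\<^sub>\<infinity>n. t n z)) has_field_derivative K * (of_real pi * \<i> / 4 * octant' a X)) (at 0)"
    by (rule DERIV_cmult)
  then show "theta' (of_int a / 4) \<delta> \<tau> 0 = K * (of_real pi * \<i> / 4 * octant' a X)"
    unfolding theta'_def theta_eq by (rule DERIV_imp_deriv)
qed

text \<open>
The common form of the eight formulas. Rotating the nome by \<open>\<iota>\<close> fixes the even part of
\<open>\<phi>\<close>, which is \<open>\<theta>[0, 0](\<tau>, 0)\<close>, and multiplies the odd part, which is
\<open>\<theta>[1, 0](\<tau>, 0)\<close>, by \<open>\<iota>\<close>; this is why \<open>p\<close> is a combination of just these two.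
\<close>

lemma theta_eighth_log_derivative:
  fixes \<iota> \<tau> p q :: complex and \<delta> :: real
  assumes \<tau>: "Im \<tau> > 0" and \<iota>: "\<iota> ^ 4 = 1"
    and p: "p = theta 0 0 \<tau> 0 - \<iota> * theta 1 0 \<tau> 0" and q: "q = phi (\<iota>\<^sup>2 * ee (\<tau> / 4))"
  shows "\<iota> = ee (of_real \<delta> / 2) \<Longrightarrow>
      theta' (1 / 4) \<delta> \<tau> 0 = of_real pi * \<i> / 4 * theta (1 / 4) \<delta> \<tau> 0 * (p * (2 * q - p))"
    and "\<iota> ^ 3 = ee (of_real \<delta> / 2) \<Longrightarrow>
      theta' (3 / 4) \<delta> \<tau> 0 = of_real pi * \<i> / 4 * theta (3 / 4) \<delta> \<tau> 0 * (p * (2 * q + p))"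
proof -
  define x where "x = ee (\<tau> / 8)"
  have x: "x \<noteq> 0" "norm x < 1"
    using ee_nome[OF \<tau>, of 8] by (auto simp: x_def)
  have n\<iota>: "norm \<iota> = 1" using \<iota> by (rule norm_fourth_root_of_unity)
  have X: "\<iota> * x \<noteq> 0" "norm (\<iota> * x) < 1" "- (\<iota> * x) \<noteq> 0" "norm (- (\<iota> * x)) < 1"
    using x \<iota> n\<iota> by (auto simp: norm_mult)
  have "phi (- (\<iota> * x)) = phi_even ((-\<iota>) * x) + phi_odd ((-\<iota>) * x)"
    using phi_split[OF X(3,4)] by simp
  also have "\<dots> = phi_even x + (- \<iota>) * phi_odd x"
    using phi_even_rotate[OF x, of "-\<iota>"] phi_odd_rotate[OF x, of "-\<iota>"] \<iota> by simp
  finally have P: "phi (- (\<iota> * x)) = p"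
    using phi_even_eq[OF x] by (simp add: p theta_00 theta_10 x_def ee_powi[of _ 4, simplified])
  have Q: "phi ((\<iota> * x)\<^sup>2) = q"
    by (simp add: q x_def power_mult_distrib ee_powi[of _ 2, simplified])
  note T = theta_eighth[OF \<tau> _ \<iota>, folded x_def]
  show "theta' (1 / 4) \<delta> \<tau> 0 = of_real pi * \<i> / 4 * theta (1 / 4) \<delta> \<tau> 0 * (p * (2 * q - p))"
    if "\<iota> = ee (of_real \<delta> / 2)"
    using T[of 1 \<delta>] that octant_log_derivative(1)[OF X(1,2), unfolded P Q] by simp
  show "theta' (3 / 4) \<delta> \<tau> 0 = of_real pi * \<i> / 4 * theta (3 / 4) \<delta> \<tau> 0 * (p * (2 * q + p))"
    if "\<iota> ^ 3 = ee (of_real \<delta> / 2)"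
    using T[of 3 \<delta>] that octant_log_derivative(2)[OF X(1,2), unfolded P Q] by simp
qed

theorem theorem2p5:
  fixes \<tau> :: complex
  assumes "Im \<tau> > 0"
  shows
    "theta' (1/4) 1 \<tau> 0 =
       of_real pi * \<i> / 4 * theta (1/4) 1 \<tau> 0 *
          theta 0 0 (\<tau> / 4) 0 * (2 * theta 0 0 (\<tau> / 2) 0 - theta 0 0 (\<tau> / 4) 0) \<and>
     theta' (3/4) 1 \<tau> 0 =
       of_real pi * \<i> / 4 * theta (3/4) 1 \<tau> 0 *
          theta 0 0 (\<tau> / 4) 0 * (2 * theta 0 0 (\<tau> / 2) 0 + theta 0 0 (\<tau> / 4) 0) \<and>
     theta' (1/4) 0 \<tau> 0 =
       of_real pi * \<i> / 4 * theta (1/4) 0 \<tau> 0 *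
          (2 * theta 0 0 (\<tau> / 2) 0 * theta 0 1 (\<tau> / 4) 0
           - theta 0 0 (\<tau> / 2) 0 ^ 2 + theta 1 0 (\<tau> / 2) 0 ^ 2) \<and>
     theta' (3/4) 0 \<tau> 0 =
       of_real pi * \<i> / 4 * theta (3/4) 0 \<tau> 0 *
          (2 * theta 0 0 (\<tau> / 2) 0 * theta 0 1 (\<tau> / 4) 0
           + theta 0 0 (\<tau> / 2) 0 ^ 2 - theta 1 0 (\<tau> / 2) 0 ^ 2) \<and>
     theta' (1/4) (1/2) \<tau> 0 =
       of_real pi * \<i> / 4 * theta (1/4) (1/2) \<tau> 0 *
          (2 * theta 0 1 (\<tau> / 2) 0 * (theta 0 0 \<tau> 0 - \<i> * theta 1 0 \<tau> 0)
           - theta 0 0 \<tau> 0 ^ 2 + theta 1 0 \<tau> 0 ^ 2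
           + \<i> * theta 1 0 (\<tau> / 2) 0 ^ 2) \<and>
     theta' (1/4) (3/2) \<tau> 0 =
       of_real pi * \<i> / 4 * theta (1/4) (3/2) \<tau> 0 *
          (2 * theta 0 1 (\<tau> / 2) 0 * (theta 0 0 \<tau> 0 + \<i> * theta 1 0 \<tau> 0)
           - theta 0 0 \<tau> 0 ^ 2 + theta 1 0 \<tau> 0 ^ 2
           - \<i> * theta 1 0 (\<tau> / 2) 0 ^ 2) \<and>
     theta' (3/4) (1/2) \<tau> 0 =
       of_real pi * \<i> / 4 * theta (3/4) (1/2) \<tau> 0 *
          (2 * theta 0 1 (\<tau> / 2) 0 * (theta 0 0 \<tau> 0 + \<i> * theta 1 0 \<tau> 0)
           + theta 0 0 \<tau> 0 ^ 2 - theta 1 0 \<tau> 0 ^ 2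
           + \<i> * theta 1 0 (\<tau> / 2) 0 ^ 2) \<and>
     theta' (3/4) (3/2) \<tau> 0 =
       of_real pi * \<i> / 4 * theta (3/4) (3/2) \<tau> 0 *
          (2 * theta 0 1 (\<tau> / 2) 0 * (theta 0 0 \<tau> 0 - \<i> * theta 1 0 \<tau> 0)
           + theta 0 0 \<tau> 0 ^ 2 - theta 1 0 \<tau> 0 ^ 2
           - \<i> * theta 1 0 (\<tau> / 2) 0 ^ 2)"
proof -
  define x where "x = ee (\<tau> / 8)"
  have x: "x \<noteq> 0" "norm x < 1"
    using ee_nome[OF assms, of 8] by (auto simp: x_def)
  have x_powers: "ee (\<tau> / 4) = x\<^sup>2" "ee (\<tau> / 2) = x ^ 4"
    by (simp_all add: x_def ee_powi[of _ 2, simplified] ee_powi[of _ 4, simplified])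
  define u v w w' where "u = theta 0 0 \<tau> 0" and "v = theta 1 0 \<tau> 0"
    and "w = phi (x\<^sup>2)" and "w' = phi (-(x\<^sup>2))"
  have uv: "phi_even x = u" "phi_odd x = v"
    using phi_even_eq[OF x] by (simp_all add: u_def v_def theta_00 theta_10 x_powers flip: x_def)
  have quarter: "theta 0 0 (\<tau> / 4) 0 = u + v" "theta 0 1 (\<tau> / 4) 0 = u - v"
    using phi_split[of x] phi_split[of "-x"] x uv
    by (simp_all add: theta_00 theta_01 x_def phi_even_neg phi_odd_neg)
  have half: "theta 0 0 (\<tau> / 2) 0 = w" "theta 0 1 (\<tau> / 2) 0 = w'"
    by (simp_all add: theta_00 theta_01 x_powers w_def w'_def)
  have half_sq: "theta 1 0 (\<tau> / 2) 0 ^ 2 = 2 * u * v"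
    unfolding u_def v_def by (rule theta_10_half_sq[OF assms])
  have w_sq: "w ^ 2 = u ^ 2 + v ^ 2"
    using sq_phi[OF x] by (simp add: uv w_def)
  note defs = ee_values x_powers u_def v_def w_def w'_def power3_eq_cube
  let ?c = "of_real pi * \<i> / 4 :: complex"
  \<comment> \<open>The rotation \<open>\<iota>\<close> is \<open>e(\<delta>/2)\<close> for the characteristic \<open>1/4\<close> and its inverse for \<open>3/4\<close>,
    since \<open>\<iota>^3\<close> is the inverse of \<open>\<iota>\<close>.\<close>
  have formulas:
    "theta' (1/4) 1 \<tau> 0 = ?c * theta (1/4) 1 \<tau> 0 * ((u + v) * (2 * w - (u + v)))"
    "theta' (3/4) 1 \<tau> 0 = ?c * theta (3/4) 1 \<tau> 0 * ((u + v) * (2 * w + (u + v)))"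
    "theta' (1/4) 0 \<tau> 0 = ?c * theta (1/4) 0 \<tau> 0 * ((u - v) * (2 * w - (u - v)))"
    "theta' (3/4) 0 \<tau> 0 = ?c * theta (3/4) 0 \<tau> 0 * ((u - v) * (2 * w + (u - v)))"
    "theta' (1/4) (1/2) \<tau> 0 = ?c * theta (1/4) (1/2) \<tau> 0 * ((u - \<i> * v) * (2 * w' - (u - \<i> * v)))"
    "theta' (1/4) (3/2) \<tau> 0 = ?c * theta (1/4) (3/2) \<tau> 0 * ((u + \<i> * v) * (2 * w' - (u + \<i> * v)))"
    "theta' (3/4) (1/2) \<tau> 0 = ?c * theta (3/4) (1/2) \<tau> 0 * ((u + \<i> * v) * (2 * w' + (u + \<i> * v)))"
    "theta' (3/4) (3/2) \<tau> 0 = ?c * theta (3/4) (3/2) \<tau> 0 * ((u - \<i> * v) * (2 * w' + (u - \<i> * v)))"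
    subgoal by (rule theta_eighth_log_derivative(1)[OF assms, where \<iota> = "-1"]) (simp_all add: defs)
    subgoal by (rule theta_eighth_log_derivative(2)[OF assms, where \<iota> = "-1"]) (simp_all add: defs)
    subgoal by (rule theta_eighth_log_derivative(1)[OF assms, where \<iota> = "1"]) (simp_all add: defs)
    subgoal by (rule theta_eighth_log_derivative(2)[OF assms, where \<iota> = "1"]) (simp_all add: defs)
    subgoal by (rule theta_eighth_log_derivative(1)[OF assms, where \<iota> = "\<i>"]) (simp_all add: defs)
    subgoal by (rule theta_eighth_log_derivative(1)[OF assms, where \<iota> = "- \<i>"]) (simp_all add: defs)
    subgoal by (rule theta_eighth_log_derivative(2)[OF assms, where \<iota> = "- \<i>"]) (simp_all add: defs)
    subgoal by (rule theta_eighth_log_derivative(2)[OF assms, where \<iota> = "\<i>"]) (simp_all add: defs)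
    done
  \<comment> \<open>The squares in the stated formulas come from expanding \<open>p\<^sup>2\<close>. For \<open>\<iota> = 1\<close> its part
    \<open>u\<^sup>2 + v\<^sup>2\<close> is \<open>w\<^sup>2\<close>, and for \<open>\<iota> = \<plusminus>\<i>\<close> it is \<open>u\<^sup>2 - v\<^sup>2\<close>; the mixed term \<open>2uv\<close> is \<open>\<theta>[1, 0]\<^sup>2(\<tau>/2, 0)\<close>.\<close>
  have brackets:
    "2 * w * (u - v) - w\<^sup>2 + 2 * u * v = (u - v) * (2 * w - (u - v))"
    "2 * w * (u - v) + w\<^sup>2 - 2 * u * v = (u - v) * (2 * w + (u - v))"
    "2 * w' * (u - \<i> * v) - u\<^sup>2 + v\<^sup>2 + \<i> * (2 * u * v) = (u - \<i> * v) * (2 * w' - (u - \<i> * v))"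
    "2 * w' * (u + \<i> * v) - u\<^sup>2 + v\<^sup>2 - \<i> * (2 * u * v) = (u + \<i> * v) * (2 * w' - (u + \<i> * v))"
    "2 * w' * (u + \<i> * v) + u\<^sup>2 - v\<^sup>2 + \<i> * (2 * u * v) = (u + \<i> * v) * (2 * w' + (u + \<i> * v))"
    "2 * w' * (u - \<i> * v) + u\<^sup>2 - v\<^sup>2 - \<i> * (2 * u * v) = (u - \<i> * v) * (2 * w' + (u - \<i> * v))"
    unfolding w_sq by (simp_all add: power2_eq_square algebra_simps)
  show ?thesis
    unfolding quarter half half_sq u_def[symmetric] v_def[symmetric] brackets formulas by simp
qed

end
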